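(* Let $X$ be a Euclidean vector space and let $\vec{u},\vec{v}\in X$. Let $\vec{u}\wedge\vec{v}$ denote the determinant of $(\vec{u},\vec{v})$ in the plane they generate, oriented from $\vec{u}$ to $\vec{v}$ (with $\vec{u}\wedge\vec{v}=0$ if $\vec{u}$ and $\vec{v}$ are collinear). Let $R$ be the rotation of angle $\pi/3$ of this oriented plane; if $\vec{u}$ and $\vec{v}$ are collinear, let $R$ be the rotation of angle $\pi/3$ of any plane containing $\vec{v}$, with any orientation. Then $$\|\vec{u}\|^2+\|\vec{v}\|^2+\|\vec{u}+\vec{v}\|^2=2\left(\sqrt{3}\,\vec{u}\wedge\vec{v}+\|\vec{u}+R(\vec{v})\|^2\right)\ge 2\sqrt{3}\,\vec{u}\wedge\vec{v},$$ with equality in the inequality if $\|\vec{u}\|=\|\vec{v}\|=\|\vec{u}+\vec{v}\|$.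
   Context: A Euclidean vector space is a real vector space with an inner product $\langle\cdot,\cdot\rangle$ and associated norm $\|\cdot\|$. Planes are two-dimensional vector subspaces. When $\vec{u},\vec{v}$ are linearly independent, the plane they generate is oriented so that $(\vec{u},\vec{v})$ is a positively oriented basis, and $\vec{u}\wedge\vec{v}$ is the determinant of $(\vec{u},\vec{v})$ in any positively oriented orthonormal basis of that plane; thus in all cases $\vec{u}\wedge\vec{v}=\sqrt{\|\vec{u}\|^2\|\vec{v}\|^2-\langle\vec{u},\vec{v}\rangle^2}\ge 0$. The rotation of angle $\pi/3$ of an oriented plane is the linear map with $R(e_1)=\frac12 e_1+\frac{\sqrt3}{2}e_2$ and $R(e_2)=-\frac{\sqrt3}{2}e_1+\frac12 e_2$ for any positively oriented orthonormal basis $(e_1,e_2)$. *)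

theory Defs
  imports "HOL-Analysis.Analysis"
begin

definition is_plane :: "'a::real_vector set \<Rightarrow> bool" where
  "is_plane P \<longleftrightarrow> subspace P \<and> dim P = 2"

text \<open>The condition \<open>e1 \<noteq> e2\<close> is needed because \<open>independent\<close> speaks about the set
  \<open>{e1, e2}\<close>, which collapses to a singleton when the two vectors coincide.\<close>

definition ordered_basis :: "'a::real_vector set \<Rightarrow> 'a \<Rightarrow> 'a \<Rightarrow> bool" where
  "ordered_basis P e1 e2 \<longleftrightarrow> e1 \<noteq> e2 \<and> independent {e1, e2} \<and> span {e1, e2} = P"

text \<open>Determinant of the pair \<open>(u, v)\<close> in the basis \<open>(e1, e2)\<close>: the columns of the matrix are
  the coordinates of \<open>u\<close> and \<open>v\<close>.\<close>

definition det_in_basis :: "'a::real_vector \<Rightarrow> 'a \<Rightarrow> 'a \<Rightarrow> 'a \<Rightarrow> real" where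
  "det_in_basis e1 e2 u v =
     det (vector [vector [representation {e1, e2} u e1, representation {e1, e2} v e1],
                  vector [representation {e1, e2} u e2, representation {e1, e2} v e2]] :: real^2^2)"

text \<open>An orientation is represented by the set of all positively oriented ordered bases, i.e. by a
  class of ordered bases of the plane related by change-of-basis matrices of positive
  determinant.\<close>

definition orientation_class :: "'a::real_vector \<Rightarrow> 'a \<Rightarrow> ('a \<times> 'a) set" where
  "orientation_class e1 e2 =
     {(f1, f2). ordered_basis (span {e1, e2}) f1 f2 \<and> det_in_basis e1 e2 f1 f2 > 0}"

definition is_orientation :: "'a::real_vector set \<Rightarrow> ('a \<times> 'a) set \<Rightarrow> bool" where
  "is_orientation P Or \<longleftrightarrow> (\<exists>e1 e2. ordered_basis P e1 e2 \<and> Or = orientation_class e1 e2)"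

definition pos_orthonormal_basis :: "('a::real_inner \<times> 'a) set \<Rightarrow> 'a \<Rightarrow> 'a \<Rightarrow> bool" where
  "pos_orthonormal_basis Or e1 e2 \<longleftrightarrow>
     (e1, e2) \<in> Or \<and> norm e1 = 1 \<and> norm e2 = 1 \<and> e1 \<bullet> e2 = 0"

text \<open>The value does not depend on the positively oriented orthonormal basis, so the description
  determines a unique number when \<open>u\<close> and \<open>v\<close> are not collinear.\<close>

definition wedge :: "'a::real_inner \<Rightarrow> 'a \<Rightarrow> real"  (infixl \<open>\<and>\<^sub>d\<close> 70) where
  "u \<and>\<^sub>d v =
     (if collinear {0, u, v} then 0
      else (THE d. \<forall>e1 e2. pos_orthonormal_basis (orientation_class u v) e1 e2
                     \<longrightarrow> d = det_in_basis e1 e2 u v))"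

text \<open>\<open>R\<close> restricts to the rotation of angle \<open>\<pi>/3\<close> of the plane \<open>P\<close> with orientation \<open>Or\<close>;
  the values of \<open>R\<close> outside \<open>P\<close> are irrelevant.\<close>

definition is_rotation_pi_3 :: "'a::real_inner set \<Rightarrow> ('a \<times> 'a) set \<Rightarrow> ('a \<Rightarrow> 'a) \<Rightarrow> bool" where
  "is_rotation_pi_3 P Or R \<longleftrightarrow>
     R ` P \<subseteq> P \<and>
     (\<forall>x\<in>P. \<forall>y\<in>P. R (x + y) = R x + R y) \<and>
     (\<forall>c. \<forall>x\<in>P. R (c *\<^sub>R x) = c *\<^sub>R R x) \<and>
     (\<forall>e1 e2. pos_orthonormal_basis Or e1 e2 \<longrightarrow>
        R e1 = (1/2) *\<^sub>R e1 + (sqrt 3 / 2) *\<^sub>R e2 \<and>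
        R e2 = - (sqrt 3 / 2) *\<^sub>R e1 + (1/2) *\<^sub>R e2)"

text \<open>The oriented planes in which the rotation may take place: the plane spanned by \<open>u\<close> and \<open>v\<close>
  oriented from \<open>u\<close> to \<open>v\<close>, or, in the collinear case, any plane containing \<open>v\<close> with any
  orientation.\<close>

definition admissible_oriented_plane ::
  "'a::real_inner \<Rightarrow> 'a \<Rightarrow> 'a set \<Rightarrow> ('a \<times> 'a) set \<Rightarrow> bool" where
  "admissible_oriented_plane u v P Or \<longleftrightarrow>
     (if collinear {0, u, v} then is_plane P \<and> v \<in> P \<and> is_orientation P Or
      else P = span {u, v} \<and> Or = orientation_class u v)"

end

theory Submission
  imports Defs
begin

text \<open>
  Write \<open>A = (norm u)\<^sup>2\<close>, \<open>B = (norm v)\<^sup>2\<close> and \<open>C = u \<bullet> v\<close>. A rotation \<open>R\<close> of angle \<open>\<pi>/3\<close> acts as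
  \<open>cos (\<pi>/3)\<close> times the identity plus \<open>sin (\<pi>/3)\<close> times the quarter turn \<open>J\<close>, and
  \<open>u \<bullet> J v\<close> is minus the determinant of \<open>(u, v)\<close>. Hence
  \<open>u \<bullet> R v = C / 2 - sqrt 3 / 2 * (u \<and>\<^sub>d v)\<close>, and since \<open>R\<close> preserves the norm, expanding
  \<open>(norm (u + R v))\<^sup>2 = A + B + 2 * (u \<bullet> R v)\<close> gives the identity at once. When \<open>u\<close> and \<open>v\<close> are
  collinear, \<open>u \<bullet> J v = 0\<close> whatever plane through \<open>v\<close> and whatever orientation is used.

  What has to be supplied is the bridge from oriented bases to the inner product. Gram-Schmidt
  produces a positively oriented orthonormal basis (\<open>pos_orthonormal_basis_exists\<close>). In every such
  basis the determinant of \<open>(u, v)\<close> is the positive square root of the Gram determinant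
  \<open>A * B - C\<^sup>2\<close>: its square is that number by Lagrange's identity, and its sign is positive because
  determinants are multiplicative under change of basis. This makes the wedge well defined, with
  value \<open>sqrt (A * B - C\<^sup>2)\<close> (\<open>wedge_eq_sqrt_gram\<close>).

  The last two claims mention no rotation, and \<open>X\<close> may have dimension less than two, so that no
  rotation exists at all. They are therefore proved from the Gram determinant: half the
  left-hand side is \<open>A + B + C\<close>, and
  \<open>(A + B + C)\<^sup>2 - 3 * (A * B - C\<^sup>2) = 3/4 * (A - B)\<^sup>2 + 1/4 * (A + B + 4 * C)\<^sup>2\<close>,
  whose right-hand side vanishes when \<open>norm u = norm v = norm (u + v)\<close>, because then
  \<open>A = B = - 2 * C\<close>.
\<close>

section \<open>Determinants relative to an ordered basis\<close>

lemma ordered_basis_coords: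
  assumes "ordered_basis P e1 e2" and "x \<in> P"
  obtains a b where "x = a *\<^sub>R e1 + b *\<^sub>R e2"
proof -
  have "x \<in> span {e1, e2}"
    using assms by (simp add: ordered_basis_def)
  then obtain a where "x - a *\<^sub>R e1 \<in> span {e2}"
    by (auto simp: span_insert)
  then obtain b where "x - a *\<^sub>R e1 = b *\<^sub>R e2"
    by (auto simp: span_singleton)
  then have "x = a *\<^sub>R e1 + b *\<^sub>R e2"
    by (simp add: algebra_simps)
  then show thesis by (rule that)
qed

lemma ordered_basis_mem:
  assumes "ordered_basis P e1 e2"
  shows "e1 \<in> P" "e2 \<in> P" "a *\<^sub>R e1 + b *\<^sub>R e2 \<in> P"
proof -
  have P: "P = span {e1, e2}"
    using assms by (simp add: ordered_basis_def)
  show "e1 \<in> P" "e2 \<in> P"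
    by (simp_all add: P span_base)
  then show "a *\<^sub>R e1 + b *\<^sub>R e2 \<in> P"
    by (simp add: P span_add span_scale)
qed

lemma representation_pair:
  assumes "ordered_basis P e1 e2"
  shows "representation {e1, e2} (a *\<^sub>R e1 + b *\<^sub>R e2) e1 = a"
    and "representation {e1, e2} (a *\<^sub>R e1 + b *\<^sub>R e2) e2 = b"
proof -
  have ind: "independent {e1, e2}" and ne: "e1 \<noteq> e2"
    using assms by (auto simp: ordered_basis_def)
  have mem: "e1 \<in> span {e1, e2}" "e2 \<in> span {e1, e2}"
    by (simp_all add: span_base)
  have "representation {e1, e2} (a *\<^sub>R e1 + b *\<^sub>R e2) =
      (\<lambda>w. a * representation {e1, e2} e1 w + b * representation {e1, e2} e2 w)"
    using ind mem by (simp add: representation_add representation_scale span_scale)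
  then show "representation {e1, e2} (a *\<^sub>R e1 + b *\<^sub>R e2) e1 = a"
    and "representation {e1, e2} (a *\<^sub>R e1 + b *\<^sub>R e2) e2 = b"
    using ind ne by (auto simp: representation_basis)
qed

lemma det_in_basis_coords:
  assumes "ordered_basis P e1 e2"
  shows "det_in_basis e1 e2 (a *\<^sub>R e1 + b *\<^sub>R e2) (c *\<^sub>R e1 + d *\<^sub>R e2) = a * d - b * c"
  by (simp add: det_in_basis_def det_2 representation_pair[OF assms])

text \<open>This is multiplicativity of the determinant for the change from the basis \<open>e\<close> to the
  basis \<open>f\<close>.\<close>

lemma det_in_basis_change:
  assumes e: "ordered_basis P e1 e2" and f: "ordered_basis P f1 f2"
    and x: "x \<in> P" and y: "y \<in> P"
  shows "det_in_basis e1 e2 x y = det_in_basis e1 e2 f1 f2 * det_in_basis f1 f2 x y"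
proof -
  obtain a b where f1: "f1 = a *\<^sub>R e1 + b *\<^sub>R e2"
    using ordered_basis_coords[OF e ordered_basis_mem(1)[OF f]] by blast
  obtain c d where f2: "f2 = c *\<^sub>R e1 + d *\<^sub>R e2"
    using ordered_basis_coords[OF e ordered_basis_mem(2)[OF f]] by blast
  obtain p q where xf: "x = p *\<^sub>R f1 + q *\<^sub>R f2"
    using ordered_basis_coords[OF f x] by blast
  obtain r s where yf: "y = r *\<^sub>R f1 + s *\<^sub>R f2"
    using ordered_basis_coords[OF f y] by blast
  have xe: "x = (p * a + q * c) *\<^sub>R e1 + (p * b + q * d) *\<^sub>R e2"
    by (simp add: xf f1 f2 algebra_simps)
  have ye: "y = (r * a + s * c) *\<^sub>R e1 + (r * b + s * d) *\<^sub>R e2"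
    by (simp add: yf f1 f2 algebra_simps)
  have "det_in_basis e1 e2 x y
      = (p * a + q * c) * (r * b + s * d) - (p * b + q * d) * (r * a + s * c)"
    unfolding xe ye by (rule det_in_basis_coords[OF e])
  moreover have "det_in_basis f1 f2 x y = p * s - q * r"
    unfolding xf yf by (rule det_in_basis_coords[OF f])
  moreover have "det_in_basis e1 e2 f1 f2 = a * d - b * c"
    unfolding f1 f2 by (rule det_in_basis_coords[OF e])
  ultimately show ?thesis
    by (simp only:) (simp add: algebra_simps)
qed

text \<open>Having the same orientation is a symmetric relation: the two determinants are inverse to each
  other.\<close>

lemma det_in_basis_pos_sym:
  assumes e: "ordered_basis P e1 e2" and f: "ordered_basis P f1 f2"
    and pos: "det_in_basis f1 f2 e1 e2 > 0"
  shows "det_in_basis e1 e2 f1 f2 > 0"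
proof -
  have "det_in_basis e1 e2 e1 e2 = 1"
    using det_in_basis_coords[OF e, of 1 0 0 1] by simp
  then have "det_in_basis e1 e2 f1 f2 * det_in_basis f1 f2 e1 e2 = 1"
    using det_in_basis_change[OF e f ordered_basis_mem(1,2)[OF e]] by simp
  then show ?thesis
    using pos by (metis zero_less_mult_pos2 zero_less_one)
qed

section \<open>Positively oriented orthonormal bases\<close>

lemma orthonormal_coords:
  fixes e1 e2 x :: "'a::real_inner"
  assumes b: "ordered_basis P e1 e2" and "norm e1 = 1" "norm e2 = 1" "e1 \<bullet> e2 = 0" and "x \<in> P"
  shows "x = (x \<bullet> e1) *\<^sub>R e1 + (x \<bullet> e2) *\<^sub>R e2"
proof -
  obtain a c where "x = a *\<^sub>R e1 + c *\<^sub>R e2"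
    using ordered_basis_coords[OF b \<open>x \<in> P\<close>] by blast
  moreover have "e1 \<bullet> e1 = 1" "e2 \<bullet> e2 = 1" "e2 \<bullet> e1 = 0"
    using assms by (simp_all add: norm_eq_1 inner_commute)
  ultimately show ?thesis
    using assms by (simp add: inner_left_distrib)
qed

lemma det_in_orthonormal_basis:
  fixes e1 e2 x y :: "'a::real_inner"
  assumes "ordered_basis P e1 e2" "norm e1 = 1" "norm e2 = 1" "e1 \<bullet> e2 = 0"
    and "x \<in> P" "y \<in> P"
  shows "det_in_basis e1 e2 x y = (x \<bullet> e1) * (y \<bullet> e2) - (x \<bullet> e2) * (y \<bullet> e1)"
  using det_in_basis_coords[OF assms(1), of "x \<bullet> e1" "x \<bullet> e2" "y \<bullet> e1" "y \<bullet> e2"]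
    orthonormal_coords[OF assms(1-4)] assms(5,6) by metis

text \<open>Lagrange's identity: the determinant in orthonormal coordinates is, up to sign, determined by
  the inner product.\<close>

lemma det_in_orthonormal_basis_squared:
  fixes e1 e2 x y :: "'a::real_inner"
  assumes on: "ordered_basis P e1 e2" "norm e1 = 1" "norm e2 = 1" "e1 \<bullet> e2 = 0"
    and x: "x \<in> P" and y: "y \<in> P"
  shows "(det_in_basis e1 e2 x y)\<^sup>2 = (norm x)\<^sup>2 * (norm y)\<^sup>2 - (x \<bullet> y)\<^sup>2"
proof -
  define a b c d where "a = x \<bullet> e1" and "b = x \<bullet> e2" and "c = y \<bullet> e1" and "d = y \<bullet> e2"
  have xe: "x = a *\<^sub>R e1 + b *\<^sub>R e2" and ye: "y = c *\<^sub>R e1 + d *\<^sub>R e2"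
    unfolding a_def b_def c_def d_def
    using orthonormal_coords[OF on x] orthonormal_coords[OF on y] by blast+
  have ee: "e1 \<bullet> e1 = 1" "e2 \<bullet> e2 = 1" "e2 \<bullet> e1 = 0"
    using on by (simp_all add: norm_eq_1 inner_commute)
  have "x \<bullet> x = a\<^sup>2 + b\<^sup>2" "y \<bullet> y = c\<^sup>2 + d\<^sup>2" "x \<bullet> y = a * c + b * d"
    unfolding xe ye using on ee
    by (simp_all add: inner_left_distrib inner_right_distrib power2_eq_square)
  moreover have "det_in_basis e1 e2 x y = a * d - b * c"
    using det_in_orthonormal_basis[OF on x y] by (simp add: a_def b_def c_def d_def)
  ultimately show ?thesis
    by (simp add: power2_norm_eq_inner) (simp add: power2_eq_square algebra_simps)
qed

text \<open>Gram-Schmidt. The change of basis it performs is triangular with positive diagonal, which is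
  why it preserves the orientation.\<close>

lemma pos_orthonormal_basis_exists:
  fixes f1 f2 :: "'a::real_inner"
  assumes f: "ordered_basis P f1 f2"
  shows "\<exists>e1 e2. pos_orthonormal_basis (orientation_class f1 f2) e1 e2"
proof -
  have P: "P = span {f1, f2}" and ne: "f1 \<noteq> f2" and ind: "independent {f1, f2}"
    using f by (auto simp: ordered_basis_def)
  have f1: "f1 \<noteq> 0"
    using ind dependent_zero[of "{f1, f2}"] by auto
  define t where "t = (f1 \<bullet> f2) / (f1 \<bullet> f1)"
  define w where "w = f2 - t *\<^sub>R f1"
  have "f2 \<notin> span {f1}"
    using ind ne by (simp add: insert_commute[of f1] independent_insert)
  then have w: "w \<noteq> 0"
    by (auto simp: w_def span_singleton)
  have orth: "f1 \<bullet> w = 0"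
    using f1 by (simp add: w_def t_def inner_diff_right)
  define e1 where "e1 = (1 / norm f1) *\<^sub>R f1"
  define e2 where "e2 = (1 / norm w) *\<^sub>R w"
  have unit: "norm e1 = 1" "norm e2 = 1" and perp: "e1 \<bullet> e2 = 0"
    using f1 w orth by (simp_all add: e1_def e2_def)
  have e1f: "e1 = (1 / norm f1) *\<^sub>R f1 + 0 *\<^sub>R f2"
    by (simp add: e1_def)
  have e2f: "e2 = (- t / norm w) *\<^sub>R f1 + (1 / norm w) *\<^sub>R f2"
    by (simp add: e2_def w_def algebra_simps)
  have "det_in_basis f1 f2 e1 e2 = 1 / norm f1 * (1 / norm w) - 0 * (- t / norm w)"
    unfolding e1f e2f by (rule det_in_basis_coords[OF f])
  then have pos: "det_in_basis f1 f2 e1 e2 > 0"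
    using f1 w by simp
  have "e1 \<noteq> e2"
    using unit perp by auto
  moreover have "independent {e1, e2}"
  proof (rule pairwise_orthogonal_independent)
    show "pairwise orthogonal {e1, e2}"
      using perp by (auto simp: pairwise_def orthogonal_def inner_commute)
    show "0 \<notin> {e1, e2}"
      using unit by auto
  qed
  moreover have "span {e1, e2} = span {f1, f2}"
  proof (rule subset_antisym)
    have "e1 \<in> span {f1, f2}" "e2 \<in> span {f1, f2}"
      unfolding e1f e2f P[symmetric] by (rule ordered_basis_mem(3)[OF f])+
    then show "span {e1, e2} \<subseteq> span {f1, f2}"
      by (intro span_minimal) auto
    have "f1 = norm f1 *\<^sub>R e1" "f2 = norm w *\<^sub>R e2 + (t * norm f1) *\<^sub>R e1"
      using f1 w by (simp_all add: e1_def e2_def w_def)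
    moreover have "e1 \<in> span {e1, e2}" "e2 \<in> span {e1, e2}"
      by (simp_all add: span_base)
    ultimately have "f1 \<in> span {e1, e2}" "f2 \<in> span {e1, e2}"
      by (metis span_scale, metis span_add span_scale)
    then show "span {f1, f2} \<subseteq> span {e1, e2}"
      by (intro span_minimal) auto
  qed
  ultimately have "ordered_basis (span {f1, f2}) e1 e2"
    by (simp add: ordered_basis_def)
  then show ?thesis
    using pos unit perp by (auto simp: pos_orthonormal_basis_def orientation_class_def)
qed

section \<open>The wedge as the root of the Gram determinant\<close>

lemma ordered_basis_of_noncollinear:
  fixes u v :: "'a::real_inner"
  assumes "\<not> collinear {0, u, v}"
  shows "ordered_basis (span {u, v}) u v"
proof -
  have "u \<noteq> 0" and nv: "\<And>c. v \<noteq> c *\<^sub>R u"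
    using assms by (auto simp: collinear_lemma)
  moreover have "u \<noteq> v"
    using nv[of 1] by auto
  moreover have "v \<notin> span {u}"
    using nv by (auto simp: span_singleton)
  ultimately have "independent {v, u}"
    by (simp add: independent_insert)
  then show ?thesis
    using \<open>u \<noteq> v\<close> by (simp add: ordered_basis_def insert_commute)
qed

lemma det_in_pos_orthonormal_basis:
  fixes u v :: "'a::real_inner"
  assumes b: "ordered_basis P u v"
    and e: "pos_orthonormal_basis (orientation_class u v) e1 e2"
  shows "det_in_basis e1 e2 u v = sqrt ((norm u)\<^sup>2 * (norm v)\<^sup>2 - (u \<bullet> v)\<^sup>2)"
proof -
  have P: "P = span {u, v}"
    using b by (simp add: ordered_basis_def)
  have on: "ordered_basis P e1 e2" "norm e1 = 1" "norm e2 = 1" "e1 \<bullet> e2 = 0"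
    and "det_in_basis u v e1 e2 > 0"
    using e by (auto simp: pos_orthonormal_basis_def orientation_class_def P)
  then have "det_in_basis e1 e2 u v > 0"
    using det_in_basis_pos_sym[OF _ b] by blast
  then show ?thesis
    using det_in_orthonormal_basis_squared[OF on ordered_basis_mem(1,2)[OF b]]
    by (metis less_imp_le real_sqrt_unique)
qed

theorem wedge_eq_sqrt_gram:
  fixes u v :: "'a::real_inner"
  shows "u \<and>\<^sub>d v = sqrt ((norm u)\<^sup>2 * (norm v)\<^sup>2 - (u \<bullet> v)\<^sup>2)"
proof (cases "collinear {0, u, v}")
  case True
  then have "\<bar>u \<bullet> v\<bar> = norm u * norm v"
    by (simp add: norm_cauchy_schwarz_equal)
  then have "(u \<bullet> v)\<^sup>2 = (norm u)\<^sup>2 * (norm v)\<^sup>2"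
    by (metis power2_abs power_mult_distrib)
  then show ?thesis
    using True by (simp add: wedge_def)
next
  case False
  note b = ordered_basis_of_noncollinear[OF False]
  \<comment> \<open>Existence of a basis matters for uniqueness: otherwise every number would satisfy the
    description.\<close>
  obtain e1 e2 where e: "pos_orthonormal_basis (orientation_class u v) e1 e2"
    using pos_orthonormal_basis_exists[OF b] by blast
  have "(THE d. \<forall>e1 e2. pos_orthonormal_basis (orientation_class u v) e1 e2
           \<longrightarrow> d = det_in_basis e1 e2 u v)
      = sqrt ((norm u)\<^sup>2 * (norm v)\<^sup>2 - (u \<bullet> v)\<^sup>2)"
    using e det_in_pos_orthonormal_basis[OF b] by (intro the_equality) auto
  then show ?thesis
    using False by (simp add: wedge_def)
qed

section \<open>The rotation of angle \<open>\<pi>/3\<close>\<close>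

text \<open>Here \<open>R = I / 2 + sqrt 3 / 2 * J\<close> with \<open>J\<close> the quarter turn \<open>e1 \<mapsto> e2\<close>, \<open>e2 \<mapsto> - e1\<close>. The vector
  \<open>u\<close> may lie outside the plane: in the degenerate case \<open>v = 0\<close> the plane is unrelated to \<open>u\<close>.\<close>

lemma norm_add_rotation_pi_3:
  fixes u v :: "'a::real_inner"
  assumes R: "is_rotation_pi_3 P Or R" and e: "pos_orthonormal_basis Or e1 e2"
    and b: "ordered_basis P e1 e2" and v: "v \<in> P"
  shows "(norm (u + R v))\<^sup>2 = (norm u)\<^sup>2 + (norm v)\<^sup>2 + u \<bullet> v
           - sqrt 3 * ((u \<bullet> e1) * (v \<bullet> e2) - (u \<bullet> e2) * (v \<bullet> e1))"
proof -
  have on: "norm e1 = 1" "norm e2 = 1" "e1 \<bullet> e2 = 0"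
    using e by (auto simp: pos_orthonormal_basis_def)
  define c d where "c = v \<bullet> e1" and "d = v \<bullet> e2"
  have ve: "v = c *\<^sub>R e1 + d *\<^sub>R e2"
    unfolding c_def d_def by (rule orthonormal_coords[OF b on v])
  have mem: "e1 \<in> P" "e2 \<in> P" "c *\<^sub>R e1 \<in> P" "d *\<^sub>R e2 \<in> P"
    using ordered_basis_mem[OF b] ordered_basis_mem(3)[OF b, of c 0]
      ordered_basis_mem(3)[OF b, of 0 d] by auto
  have "R v = c *\<^sub>R R e1 + d *\<^sub>R R e2"
    using R mem unfolding ve is_rotation_pi_3_def by simp
  moreover have "R e1 = (1/2) *\<^sub>R e1 + (sqrt 3 / 2) *\<^sub>R e2"
    "R e2 = - (sqrt 3 / 2) *\<^sub>R e1 + (1/2) *\<^sub>R e2"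
    using R e unfolding is_rotation_pi_3_def by blast+
  ultimately have Rv: "R v = (c / 2 - sqrt 3 / 2 * d) *\<^sub>R e1 + (sqrt 3 / 2 * c + d / 2) *\<^sub>R e2"
    by (simp add: algebra_simps)
  have ee: "e1 \<bullet> e1 = 1" "e2 \<bullet> e2 = 1" "e2 \<bullet> e1 = 0"
    using on by (simp_all add: norm_eq_1 inner_commute)
  have s3: "sqrt 3 * sqrt 3 = 3" by simp
  have "R v \<bullet> R v = (c / 2 - sqrt 3 / 2 * d)\<^sup>2 + (sqrt 3 / 2 * c + d / 2)\<^sup>2"
    unfolding Rv using on ee
    by (simp add: inner_left_distrib inner_right_distrib power2_eq_square)
  also have "\<dots> = (1 / 4 + sqrt 3 * sqrt 3 / 4) * (c * c + d * d)"
    by (simp add: power2_eq_square field_simps)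
  also have "\<dots> = c * c + d * d"
    by (simp add: s3)
  also have "\<dots> = v \<bullet> v"
    unfolding ve using on ee by (simp add: inner_left_distrib inner_right_distrib)
  finally have "R v \<bullet> R v = v \<bullet> v" .
  moreover have "2 * (u \<bullet> R v) = u \<bullet> v - sqrt 3 * ((u \<bullet> e1) * d - (u \<bullet> e2) * c)"
  proof -
    have "u \<bullet> v = c * (u \<bullet> e1) + d * (u \<bullet> e2)"
      by (subst ve) (simp add: inner_right_distrib)
    then show ?thesis
      unfolding Rv by (simp add: inner_right_distrib algebra_simps)
  qed
  ultimately show ?thesis
    by (simp add: power2_norm_eq_inner inner_left_distrib inner_right_distrib inner_commute
        c_def d_def)
qed

lemma norm_add_rotation_pi_3_wedge:
  fixes u v :: "'a::real_inner"
  assumes adm: "admissible_oriented_plane u v P Or" and R: "is_rotation_pi_3 P Or R"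
  shows "(norm (u + R v))\<^sup>2 = (norm u)\<^sup>2 + (norm v)\<^sup>2 + u \<bullet> v - sqrt 3 * (u \<and>\<^sub>d v)"
proof -
  obtain f1 f2 where f: "ordered_basis P f1 f2" and Or: "Or = orientation_class f1 f2"
    and v: "v \<in> P" and uv: "\<not> collinear {0, u, v} \<longrightarrow> f1 = u \<and> f2 = v"
  proof (cases "collinear {0, u, v}")
    case True
    then show thesis
      using adm that by (auto simp: admissible_oriented_plane_def is_orientation_def)
  next
    case False
    then show thesis
      using adm that[of u v] ordered_basis_of_noncollinear[OF False]
      by (auto simp: admissible_oriented_plane_def span_base)
  qed
  obtain e1 e2 where e: "pos_orthonormal_basis Or e1 e2"
    using pos_orthonormal_basis_exists[OF f] Or by blast
  have b: "ordered_basis P e1 e2"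
    using e f by (auto simp: Or pos_orthonormal_basis_def orientation_class_def ordered_basis_def)
  have "(u \<bullet> e1) * (v \<bullet> e2) - (u \<bullet> e2) * (v \<bullet> e1) = u \<and>\<^sub>d v"
  proof (cases "collinear {0, u, v}")
    case True
    then have "u = 0 \<or> v = 0 \<or> (\<exists>c. v = c *\<^sub>R u)"
      by (simp add: collinear_lemma)
    then show ?thesis
      using True by (auto simp: wedge_def)
  next
    case False
    then have [simp]: "f1 = u" "f2 = v"
      using uv by auto
    have "det_in_basis e1 e2 u v = (u \<bullet> e1) * (v \<bullet> e2) - (u \<bullet> e2) * (v \<bullet> e1)"
      using e b ordered_basis_mem(1,2)[OF f]
      by (intro det_in_orthonormal_basis) (auto simp: pos_orthonormal_basis_def)
    moreover have "det_in_basis e1 e2 u v = u \<and>\<^sub>d v"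
      using det_in_pos_orthonormal_basis[OF f] e by (simp add: Or wedge_eq_sqrt_gram)
    ultimately show ?thesis by simp
  qed
  then show ?thesis
    using norm_add_rotation_pi_3[OF R e b v] by simp
qed

section \<open>The inequality and the identity\<close>

lemma norm_add_squared:
  fixes u v :: "'a::real_inner"
  shows "(norm (u + v))\<^sup>2 = (norm u)\<^sup>2 + (norm v)\<^sup>2 + 2 * (u \<bullet> v)"
  by (simp add: power2_norm_eq_inner inner_left_distrib inner_right_distrib inner_commute)

lemma sum_squares_ge_wedge:
  fixes u v :: "'a::real_inner"
  shows "(norm u)\<^sup>2 + (norm v)\<^sup>2 + (norm (u + v))\<^sup>2 \<ge> 2 * sqrt 3 * (u \<and>\<^sub>d v)"
proof -
  define A B C where "A = (norm u)\<^sup>2" and "B = (norm v)\<^sup>2" and "C = u \<bullet> v"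
  have sum: "A + B + (norm (u + v))\<^sup>2 = 2 * (A + B + C)"
    by (simp add: norm_add_squared A_def B_def C_def)
  have "0 \<le> A + B + (norm (u + v))\<^sup>2"
    by (simp add: A_def B_def)
  then have nonneg: "0 \<le> A + B + C"
    using sum by simp
  have "(A + B + C)\<^sup>2 - 3 * (A * B - C\<^sup>2) = 3/4 * (A - B)\<^sup>2 + 1/4 * (A + B + 4 * C)\<^sup>2"
    by (simp add: power2_eq_square field_simps)
  also have "\<dots> \<ge> 0" by simp
  finally have "sqrt (3 * (A * B - C\<^sup>2)) \<le> A + B + C"
    using nonneg by (intro real_le_lsqrt) auto
  then have "sqrt 3 * (u \<and>\<^sub>d v) \<le> A + B + C"
    by (simp only: wedge_eq_sqrt_gram A_def B_def C_def real_sqrt_mult)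
  then show ?thesis
    using sum by (simp add: A_def B_def)
qed

lemma sum_squares_eq_wedge:
  fixes u v :: "'a::real_inner"
  assumes "norm u = norm v" and "norm v = norm (u + v)"
  shows "(norm u)\<^sup>2 + (norm v)\<^sup>2 + (norm (u + v))\<^sup>2 = 2 * sqrt 3 * (u \<and>\<^sub>d v)"
proof -
  define A where "A = (norm v)\<^sup>2"
  have A: "(norm u)\<^sup>2 = A" "(norm v)\<^sup>2 = A" "(norm (u + v))\<^sup>2 = A"
    using assms by (simp_all add: A_def)
  have C: "u \<bullet> v = - A / 2"
    using norm_add_squared[of u v] A by simp
  have "sqrt 3 * (u \<and>\<^sub>d v) = sqrt (3 * (A * A - (- A / 2)\<^sup>2))"
    by (simp only: wedge_eq_sqrt_gram A C real_sqrt_mult)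
  also have "3 * (A * A - (- A / 2)\<^sup>2) = (3 / 2 * A)\<^sup>2"
    by (simp add: power2_eq_square field_simps)
  also have "sqrt \<dots> = 3 / 2 * A"
    by (simp add: A_def)
  finally show ?thesis
    using A by simp
qed

theorem theorem2p1:
  fixes u v :: "'a::real_inner"
  shows "(\<forall>P Or R. admissible_oriented_plane u v P Or \<longrightarrow> is_rotation_pi_3 P Or R \<longrightarrow>
            (norm u)\<^sup>2 + (norm v)\<^sup>2 + (norm (u + v))\<^sup>2
              = 2 * (sqrt 3 * (u \<and>\<^sub>d v) + (norm (u + R v))\<^sup>2) \<and>
            2 * (sqrt 3 * (u \<and>\<^sub>d v) + (norm (u + R v))\<^sup>2) \<ge> 2 * sqrt 3 * (u \<and>\<^sub>d v)) \<and>
         (norm u)\<^sup>2 + (norm v)\<^sup>2 + (norm (u + v))\<^sup>2 \<ge> 2 * sqrt 3 * (u \<and>\<^sub>d v) \<and>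
         (norm u = norm v \<and> norm v = norm (u + v) \<longrightarrow>
            (norm u)\<^sup>2 + (norm v)\<^sup>2 + (norm (u + v))\<^sup>2 = 2 * sqrt 3 * (u \<and>\<^sub>d v))"
proof (intro conjI allI impI)
  fix P :: "'a set" and Or R
  assume "admissible_oriented_plane u v P Or" and "is_rotation_pi_3 P Or R"
  then show "(norm u)\<^sup>2 + (norm v)\<^sup>2 + (norm (u + v))\<^sup>2
      = 2 * (sqrt 3 * (u \<and>\<^sub>d v) + (norm (u + R v))\<^sup>2)"
    by (simp add: norm_add_rotation_pi_3_wedge norm_add_squared[of u v])
  show "2 * (sqrt 3 * (u \<and>\<^sub>d v) + (norm (u + R v))\<^sup>2) \<ge> 2 * sqrt 3 * (u \<and>\<^sub>d v)"
    by simp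
next
  show "(norm u)\<^sup>2 + (norm v)\<^sup>2 + (norm (u + v))\<^sup>2 \<ge> 2 * sqrt 3 * (u \<and>\<^sub>d v)"
    by (rule sum_squares_ge_wedge)
next
  assume "norm u = norm v \<and> norm v = norm (u + v)"
  then show "(norm u)\<^sup>2 + (norm v)\<^sup>2 + (norm (u + v))\<^sup>2 = 2 * sqrt 3 * (u \<and>\<^sub>d v)"
    by (intro sum_squares_eq_wedge) simp_all
qed

end
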